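(* Let $F\in\mathbb{R}^{n\times n}$, $G\in\mathbb{R}^{n\times q}$, $H\in\mathbb{R}^{m\times n}$ be constant matrices, let $Q\in\mathbb{R}^{q\times q}$ and $R\in\mathbb{R}^{m\times m}$ be covariance matrices (symmetric positive semidefinite, with $R$ invertible), let $\Pi_0\in\mathbb{R}^{n\times n}$ be symmetric positive definite, and let $\lambda>0$ be a constant scalar. Let $(P_{k|k-1})_{k\ge 0}$ be a sequence of symmetric matrices in $\mathbb{R}^{n\times n}$ with $P_{0|-1}=\Pi_0$ such that, for all $k\ge 0$, the matrix $$R_{e,k}^{\lambda}=\lambda H P_{k|k-1}H^{\top}+R$$ is invertible, and put $$K_{p,k}=F P_{k|k-1}H^{\top}[R_{e,k}^{\lambda}]^{-1},\qquad k\ge 0 .$$ Write $\Delta[P_{k+1|k}]=P_{k+1|k}-P_{k|k-1}$ for $k\ge 0$ (so that $\Delta[P_{k|k-1}]=P_{k|k-1}-P_{k-1|k-2}$ for $k\ge1$). Then the following three statements are equivalent. (a) (Riccati-type recursion) For all $k\ge 0$, $$P_{k+1|k}=F P_{k|k-1}F^{\top}+GQG^{\top}-\lambda K_{p,k}R_{e,k}^{\lambda}K_{p,k}^{\top}.$$ (b) (First Chandrasekhar-type recursion) $P_{1|0}=F\Pi_0F^{\top}+GQG^{\top}-\lambda K_{p,0}R_{e,0}^{\lambda}K_{p,0}^{\top}$, and for all $k\ge 1$, $$\Delta[P_{k+1|k}]=\bigl(F-\lambda K_{p,k}H\bigr)\Bigl(\Delta[P_{k|k-1}]+\lambda\,\Delta[P_{k|k-1}]H^{\top}[R_{e,k-1}^{\lambda}]^{-1}H\,\Delta[P_{k|k-1}]\Bigr)\bigl(F-\lambda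 K_{p,k}H\bigr)^{\top}.$$ (c) (Second Chandrasekhar-type recursion) $P_{1|0}=F\Pi_0F^{\top}+GQG^{\top}-\lambda K_{p,0}R_{e,0}^{\lambda}K_{p,0}^{\top}$, and for all $k\ge 1$, $$\Delta[P_{k+1|k}]=\bigl(F-\lambda K_{p,k-1}H\bigr)\Bigl(\Delta[P_{k|k-1}]-\lambda\,\Delta[P_{k|k-1}]H^{\top}[R_{e,k}^{\lambda}]^{-1}H\,\Delta[P_{k|k-1}]\Bigr)\bigl(F-\lambda K_{p,k-1}H\bigr)^{\top}.$$
   Context: The setting is the improved maximum correntropy criterion Kalman filter (IMCC-KF) for the linear time-invariant discrete-time stochastic system $x_{k+1}=Fx_k+Gw_k$, $y_k=Hx_k+v_k$, $k\ge 0$, where $w_k$, $v_k$ are zero-mean, mutually uncorrelated white noises with covariances $Q$ and $R$, uncorrelated with the initial state $x_0$, which has mean $\bar x_0$ and covariance $\Pi_0$. The Riccati-based IMCC-KF in a priori form with a constant scalar adjusting weight $\lambda$ consists of the state recursion $\hat x_{k+1|k}=F\hat x_{k|k-1}+\lambda K_{p,k}(y_k-H\hat x_{k|k-1})$ with $\hat x_{0|-1}=\bar x_0$, the gain formula for $K_{p,k}$, and the Riccati-type recursion for the error covariance $P_{k+1|k}$ with $P_{0|-1}=\Pi_0$. The formulas for the state, for $R_{e,k}^{\lambda}$ and for $K_{p,k}$ are common to the Riccati- and Chandrasekhar-type filters; the equivalence concerns how the matrices $P_{k+1|k}$ are propagated. The claim itself is purely a deterministic matrix statement. The notation $\Delta[A_k]=A_k-A_{k-1}$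 is the backward difference of a matrix sequence; the double subscript in $P_{k|k-1}$ is just indexing by $k$. *)

theory Defs
  imports "HOL-Analysis.Analysis"
begin

definition sym_matrix :: "real^'n^'n \<Rightarrow> bool" where
  "sym_matrix A \<longleftrightarrow> transpose A = A"

definition pos_semidef :: "real^'n^'n \<Rightarrow> bool" where
  "pos_semidef A \<longleftrightarrow> sym_matrix A \<and> (\<forall>x. 0 \<le> x \<bullet> (A *v x))"

definition pos_def :: "real^'n^'n \<Rightarrow> bool" where
  "pos_def A \<longleftrightarrow> sym_matrix A \<and> (\<forall>x. x \<noteq> 0 \<longrightarrow> 0 < x \<bullet> (A *v x))"

(* Only meaningful for k > 0: subtraction on nat truncates, so the value at 0 is A 0 - A 0. *)
definition backward_diff :: "(nat \<Rightarrow> 'a::ab_group_add) \<Rightarrow> nat \<Rightarrow> 'a" where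
  "backward_diff A k = A k - A (k - 1)"

end

theory Submission
  imports Defs
begin

text \<open>
  Put \<open>M\<^sub>k = \<lambda> H\<^sup>T S\<^sub>k\<inverse> H\<close> and \<open>D = P\<^sub>k - P\<^bsub>k-1\<^esub>\<close>. The resolvent identity for \<open>S\<^bsub>k-1\<^esub>\<close>, \<open>S\<^sub>k\<close> gives
  \<open>M\<^bsub>k-1\<^esub> - M\<^sub>k = M\<^bsub>k-1\<^esub> D M\<^sub>k = M\<^sub>k D M\<^bsub>k-1\<^esub>\<close>. Both Chandrasekhar right-hand sides therefore equal
  \<open>F (I - P\<^bsub>k-1\<^esub> M\<^bsub>k-1\<^esub>) D (I - M\<^sub>k P\<^sub>k) F\<^sup>T\<close>, and this is the increment of the Riccati map
  \<open>P \<mapsto> F (P - P M P) F\<^sup>T + G Q G\<^sup>T\<close> between \<open>P\<^bsub>k-1\<^esub>\<close> and \<open>P\<^sub>k\<close>, whatever the sequence \<open>P\<close>.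
  So each Chandrasekhar recursion is the differenced Riccati recursion.
\<close>

lemma matrix_add_rdistrib: "(B + C) ** A = B ** A + C ** (A :: real^'n^'m)"
  by (simp add: vec_eq_iff matrix_matrix_mult_def distrib_right sum.distrib)

lemma matrix_sub_ldistrib: "A ** (B - C) = A ** B - A ** (C :: real^'n^'m)"
  by (simp add: vec_eq_iff matrix_matrix_mult_def right_diff_distrib sum_subtractf)

lemma matrix_sub_rdistrib: "(B - C) ** A = B ** A - C ** (A :: real^'n^'m)"
  by (simp add: vec_eq_iff matrix_matrix_mult_def left_diff_distrib sum_subtractf)

lemma scaleR_matrix_mult_left: "(c *\<^sub>R A) ** B = c *\<^sub>R (A ** (B :: real^'n^'m))"
  by (rule scalar_matrix_assoc [symmetric])

lemma scaleR_matrix_mult_right: "A ** (c *\<^sub>R B) = c *\<^sub>R (A ** (B :: real^'n^'m))"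
  by (simp add: matrix_scalar_ac scaleR_matrix_mult_left)

lemma transpose_diff: "transpose (A - B) = transpose A - transpose B"
  by (simp add: vec_eq_iff transpose_def)

lemma transpose_add: "transpose (A + B) = transpose A + transpose B"
  by (simp add: vec_eq_iff transpose_def)

lemmas matrix_ring_simps =
  matrix_add_ldistrib matrix_add_rdistrib matrix_sub_ldistrib matrix_sub_rdistrib
  scaleR_matrix_mult_left scaleR_matrix_mult_right matrix_mul_assoc

lemma matrix_inv_mult:
  assumes "invertible A"
  shows "A ** matrix_inv A = mat 1" "matrix_inv A ** A = mat 1"
  using someI_ex [OF assms [unfolded invertible_def]] unfolding matrix_inv_def by auto

lemma transpose_matrix_inv:
  fixes A :: "real^'n^'n"
  assumes "invertible A"
  shows "transpose (matrix_inv A) = matrix_inv (transpose A)"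
proof -
  have "transpose (matrix_inv A) ** transpose A = mat 1"
    by (metis assms matrix_inv_mult(1) matrix_transpose_mul transpose_mat)
  then show ?thesis
    by (metis assms matrix_inv_mult(1) matrix_mul_assoc matrix_mul_lid matrix_mul_rid
        transpose_invertible)
qed

lemma matrix_inv_diff:
  fixes A B :: "real^'n^'n"
  assumes "invertible A" "invertible B"
  shows "matrix_inv A - matrix_inv B = matrix_inv A ** (B - A) ** matrix_inv B"
proof -
  have "matrix_inv A ** B ** matrix_inv B = matrix_inv A"
    by (metis assms(2) matrix_inv_mult(1) matrix_mul_assoc matrix_mul_rid)
  then show ?thesis
    by (simp add: matrix_ring_simps matrix_inv_mult assms)
qed

text \<open>In the expanded product the term \<open>P1 ** M1 ** (P2 - P1) ** M2 ** P2\<close>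
  becomes \<open>P1 ** (M1 - M2) ** P2\<close> by the assumption, and this cancels both mixed terms
  containing \<open>P1\<close> and \<open>P2\<close>.\<close>

lemma riccati_increment_middle:
  fixes P1 P2 M1 M2 :: "real^'n^'n"
  assumes "M1 - M2 = M1 ** (P2 - P1) ** M2"
  shows "(mat 1 - P1 ** M1) ** (P2 - P1) ** (mat 1 - M2 ** P2)
           = (P2 - P2 ** M2 ** P2) - (P1 - P1 ** M1 ** P1)"
proof -
  have "P1 ** (M1 ** (P2 - P1) ** M2) ** P2 = P1 ** (M1 - M2) ** P2"
    using assms by simp
  then show ?thesis
    by (simp add: matrix_ring_simps algebra_simps)
qed

text \<open>The left gain factor absorbs the quadratic correction, leaving
  \<open>(mat 1 - P1 ** M1) ** D\<close>. What remains is the middle form.\<close>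

lemma riccati_increment_new_gain:
  fixes P1 P2 M1 M2 :: "real^'n^'n"
  defines "D \<equiv> P2 - P1"
  assumes "M1 - M2 = M1 ** D ** M2" and "M1 - M2 = M2 ** D ** M1"
  shows "(mat 1 - P2 ** M2) ** (D + D ** M1 ** D) ** (mat 1 - M2 ** P2)
           = (P2 - P2 ** M2 ** P2) - (P1 - P1 ** M1 ** P1)"
proof -
  have "(mat 1 - P2 ** M2) ** (D + D ** M1 ** D)
          = D + D ** M1 ** D - P2 ** (M2 + M2 ** D ** M1) ** D"
    by (simp add: matrix_ring_simps algebra_simps)
  also have "M2 + M2 ** D ** M1 = M1"
    using assms(3) by (simp add: algebra_simps)
  \<comment> \<open>Here \<open>D - P2 = - P1\<close>, so the new \<open>P2\<close> is replaced by
    the old \<open>P1\<close>.\<close>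
  also have "D + D ** M1 ** D - P2 ** M1 ** D = (mat 1 - P1 ** M1) ** D"
    unfolding D_def by (simp add: matrix_ring_simps algebra_simps)
  finally show ?thesis
    using riccati_increment_middle [of M1 M2 P2 P1] assms(2) unfolding D_def by simp
qed

text \<open>Mirror image: now the right gain factor absorbs the correction, since
  \<open>D + P1 = P2\<close>, leaving \<open>D ** (mat 1 - M2 ** P2)\<close>.\<close>

lemma riccati_increment_old_gain:
  fixes P1 P2 M1 M2 :: "real^'n^'n"
  defines "D \<equiv> P2 - P1"
  assumes "M1 - M2 = M1 ** D ** M2" and "M1 - M2 = M2 ** D ** M1"
  shows "(mat 1 - P1 ** M1) ** (D - D ** M2 ** D) ** (mat 1 - M1 ** P1)
           = (P2 - P2 ** M2 ** P2) - (P1 - P1 ** M1 ** P1)"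
proof -
  have "(D - D ** M2 ** D) ** (mat 1 - M1 ** P1)
          = D - D ** M2 ** D - D ** (M1 - M2 ** D ** M1) ** P1"
    by (simp add: matrix_ring_simps algebra_simps)
  also have "M1 - M2 ** D ** M1 = M2"
    using assms(3) by (simp add: algebra_simps)
  also have "D - D ** M2 ** D - D ** M2 ** P1 = D ** (mat 1 - M2 ** P2)"
    unfolding D_def by (simp add: matrix_ring_simps algebra_simps)
  finally show ?thesis
    using riccati_increment_middle [of M1 M2 P2 P1] assms(2) unfolding D_def
    by (simp flip: matrix_mul_assoc)
qed

text \<open>The differences telescope from the initial equation. As \<open>f\<close> is arbitrary,
  it may itself be built from \<open>P\<close>.\<close>

lemma recursion_iff_differenced:
  fixes P :: "nat \<Rightarrow> 'a::ab_group_add"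
  shows "(\<forall>k. P (k + 1) = f k) \<longleftrightarrow>
         P 1 = f 0 \<and> (\<forall>k\<ge>1. backward_diff P (k + 1) = f k - f (k - 1))"
proof (intro iffI conjI allI impI)
  assume rec: "\<forall>k. P (k + 1) = f k"
  show "P 1 = f 0"
    using rec [rule_format, of 0] by simp
  fix k :: nat assume "k \<ge> 1"
  then show "backward_diff P (k + 1) = f k - f (k - 1)"
    using rec [rule_format, of k] rec [rule_format, of "k - 1"]
    by (simp add: backward_diff_def)
next
  fix k
  assume *: "P 1 = f 0 \<and> (\<forall>k\<ge>1. backward_diff P (k + 1) = f k - f (k - 1))"
  show "P (k + 1) = f k"
  proof (induction k)
    case 0
    then show ?case using * by simp
  next
    case (Suc k)
    then show ?case
      using *[THEN conjunct2, rule_format, of "Suc k"] by (simp add: backward_diff_def)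
  qed
qed

theorem lemma1:
  fixes F :: "real^'n^'n"
    and G :: "real^'q^'n"
    and H :: "real^'n^'m"
    and Q :: "real^'q^'q"
    and R :: "real^'m^'m"
    and \<Pi>0 :: "real^'n^'n"
    and lam :: real
    and P :: "nat \<Rightarrow> real^'n^'n"
    and S :: "nat \<Rightarrow> real^'m^'m"
    and K :: "nat \<Rightarrow> real^'m^'n"
  assumes "pos_semidef Q"
    and "pos_semidef R" and "invertible R"
    and "pos_def \<Pi>0"
    and "lam > 0"
    and "\<And>k. sym_matrix (P k)"
    and "P 0 = \<Pi>0"
    and S_def: "\<And>k. S k = lam *\<^sub>R (H ** P k ** transpose H) + R"
    and "\<And>k. invertible (S k)"
    and K_def: "\<And>k. K k = F ** P k ** transpose H ** matrix_inv (S k)"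
  defines "riccati \<equiv>
      (\<forall>k. P (k + 1) = F ** P k ** transpose F + G ** Q ** transpose G
                        - lam *\<^sub>R (K k ** S k ** transpose (K k)))"
    and "initial \<equiv>
      (P 1 = F ** \<Pi>0 ** transpose F + G ** Q ** transpose G
              - lam *\<^sub>R (K 0 ** S 0 ** transpose (K 0)))"
    and "chandrasekhar1 \<equiv>
      (\<forall>k\<ge>1. backward_diff P (k + 1) =
         (F - lam *\<^sub>R (K k ** H))
         ** (backward_diff P k
             + lam *\<^sub>R (backward_diff P k ** transpose H ** matrix_inv (S (k - 1))
                           ** H ** backward_diff P k))
         ** transpose (F - lam *\<^sub>R (K k ** H)))"
    and "chandrasekhar2 \<equiv>
      (\<forall>k\<ge>1. backward_diff P (k + 1) =
         (F - lam *\<^sub>R (K (k - 1) ** H))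
         ** (backward_diff P k
             - lam *\<^sub>R (backward_diff P k ** transpose H ** matrix_inv (S k)
                           ** H ** backward_diff P k))
         ** transpose (F - lam *\<^sub>R (K (k - 1) ** H)))"
  shows "(riccati \<longleftrightarrow> initial \<and> chandrasekhar1) \<and>
         (initial \<and> chandrasekhar1 \<longleftrightarrow> initial \<and> chandrasekhar2)"
proof -
  define M where "M k = lam *\<^sub>R (transpose H ** matrix_inv (S k) ** H)" for k
  \<comment> \<open>The Riccati right-hand side at the given \<open>P k\<close>; no recursion for
    \<open>P\<close> is assumed.\<close>
  define f where "f k = F ** P k ** transpose F + G ** Q ** transpose G
                         - lam *\<^sub>R (K k ** S k ** transpose (K k))" for k
  have P_sym: "transpose (P k) = P k" for k
    using assms(6) by (simp add: sym_matrix_def)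
  have "transpose R = R"
    using assms(2) by (simp add: pos_semidef_def sym_matrix_def)
  then have "transpose (S k) = S k" for k
    by (simp add: S_def transpose_add transpose_scalar matrix_transpose_mul P_sym
        matrix_mul_assoc)
  then have S_inv_sym: "transpose (matrix_inv (S k)) = matrix_inv (S k)" for k
    by (simp add: transpose_matrix_inv assms(9))
  have M_sym: "transpose (M k) = M k" for k
    by (simp add: M_def transpose_scalar matrix_transpose_mul S_inv_sym matrix_mul_assoc)
  have gain: "F - lam *\<^sub>R (K k ** H) = F ** (mat 1 - P k ** M k)" for k
    by (simp add: K_def M_def matrix_ring_simps)
  have gain_transpose: "transpose (F - lam *\<^sub>R (K k ** H)) = (mat 1 - M k ** P k) ** transpose F" for k
    by (simp add: gain matrix_transpose_mul transpose_diff transpose_mat M_sym P_sym)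
  have correction: "lam *\<^sub>R (D ** transpose H ** matrix_inv (S k) ** H ** D) = D ** M k ** D" for D k
    by (simp add: M_def matrix_ring_simps)
  have f_eq: "f k = F ** (P k - P k ** M k ** P k) ** transpose F + G ** Q ** transpose G" for k
  proof -
    \<comment> \<open>One \<open>S k\<close> cancels against the inverse in the gain, so the
      quadratic term becomes \<open>F ** P k ** M k ** P k ** transpose F\<close>.\<close>
    have "K k ** S k = F ** P k ** transpose H"
      by (metis K_def assms(9) matrix_inv_mult(2) matrix_mul_assoc matrix_mul_rid)
    then show ?thesis
      by (simp add: f_def M_def K_def matrix_transpose_mul S_inv_sym P_sym matrix_ring_simps)
  qed
  have M_diff: "M i - M j = M i ** (P j - P i) ** M j" for i j
  proof -
    have "M i - M j = lam *\<^sub>R (transpose H ** (matrix_inv (S i) - matrix_inv (S j)) ** H)"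
      by (simp add: M_def matrix_ring_simps scaleR_right_diff_distrib)
    also have "matrix_inv (S i) - matrix_inv (S j) = matrix_inv (S i) ** (S j - S i) ** matrix_inv (S j)"
      by (simp add: matrix_inv_diff assms(9))
    \<comment> \<open>The constant \<open>R\<close> cancels. The factor \<open>lam\<close> gained
      here, together with the outer one, supplies one for each of \<open>M i\<close> and
      \<open>M j\<close>.\<close>
    also have "S j - S i = lam *\<^sub>R (H ** (P j - P i) ** transpose H)"
      by (simp add: S_def matrix_ring_simps scaleR_right_diff_distrib)
    also have "lam *\<^sub>R (transpose H ** (matrix_inv (S i) ** \<dots> ** matrix_inv (S j)) ** H)
                 = M i ** (P j - P i) ** M j"
      by (simp only: M_def scaleR_matrix_mult_left scaleR_matrix_mult_right matrix_mul_assoc)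
    finally show ?thesis .
  qed
  \<comment> \<open>Transposition reverses the product and fixes the symmetric \<open>M\<close> and
    \<open>P\<close>.\<close>
  have M_diff': "M i - M j = M j ** (P j - P i) ** M i" for i j
    using arg_cong [OF M_diff [of i j], of transpose]
    by (simp add: transpose_diff matrix_transpose_mul M_sym P_sym matrix_mul_assoc)
  have f_diff: "f k - f (k - 1)
      = F ** ((P k - P k ** M k ** P k) - (P (k - 1) - P (k - 1) ** M (k - 1) ** P (k - 1)))
          ** transpose F" for k
    unfolding f_eq by (simp add: matrix_ring_simps)
  \<comment> \<open>This holds even at \<open>k = 0\<close>, where truncated subtraction makes both
    sides zero, so it can rewrite under the quantifier without a side condition.\<close>
  have increment1: "(F - lam *\<^sub>R (K k ** H))
         ** (backward_diff P k
             + lam *\<^sub>R (backward_diff P k ** transpose H ** matrix_inv (S (k - 1))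
                           ** H ** backward_diff P k))
         ** transpose (F - lam *\<^sub>R (K k ** H)) = f k - f (k - 1)" for k
    \<comment> \<open>The transposed gain goes first: \<open>gain\<close> would otherwise rewrite
      inside it and destroy the pattern.\<close>
    unfolding gain_transpose unfolding gain correction f_diff backward_diff_def
      riccati_increment_new_gain [OF M_diff M_diff', symmetric]
    by (simp only: matrix_mul_assoc)
  have increment2: "(F - lam *\<^sub>R (K (k - 1) ** H))
         ** (backward_diff P k
             - lam *\<^sub>R (backward_diff P k ** transpose H ** matrix_inv (S k)
                           ** H ** backward_diff P k))
         ** transpose (F - lam *\<^sub>R (K (k - 1) ** H)) = f k - f (k - 1)" for k
    unfolding gain_transpose unfolding gain correction f_diff backward_diff_def
      riccati_increment_old_gain [OF M_diff M_diff', symmetric]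
    by (simp only: matrix_mul_assoc)
  have "riccati \<longleftrightarrow> (\<forall>k. P (k + 1) = f k)"
    by (simp add: riccati_def f_def)
  moreover have "initial \<longleftrightarrow> P 1 = f 0"
    by (simp add: initial_def f_def assms(7))
  ultimately show ?thesis
    unfolding chandrasekhar1_def chandrasekhar2_def increment1 increment2
    using recursion_iff_differenced [of P f] by blast
qed

end
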